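(* Let $\mathbb{F}$ be an algebraically closed field of arbitrary characteristic, let $\mathbf{O}$ be the split octonion algebra over $\mathbb{F}$, and let $\mathrm{G}_2=\mathrm{Aut}(\mathbf{O})$ act diagonally on $\mathbf{O}^2$. Then the set of pairs consisting of the union of the following families is a minimal set of representatives of the $\mathrm{G}_2$-orbits on $\mathbf{O}^2$ (i.e. every $\mathrm{G}_2$-orbit on $\mathbf{O}^2$ contains exactly one element of this set), where $\alpha_1,\alpha_8,\beta_1,\beta_2,\beta_5,\beta_8$ range over $\mathbb{F}$ subject to the indicated conditions: (EE) $(\alpha_1 1_{\mathbf{O}},\ \beta_1 1_{\mathbf{O}})$; (E$\overline{\mathrm F}$) $\left(\alpha_1 1_{\mathbf{O}},\ \begin{pmatrix}\beta_1&\mathbf{0}\\ \mathbf{0}&\beta_8\end{pmatrix}\right)$ with $\beta_1<\beta_8$; (EK$_1$) $\left(\alpha_1 1_{\mathbf{O}},\ \begin{pmatrix}\beta_1&(1,0,0)\\ \mathbf{0}&\beta_1\end{pmatrix}\right)$; ($\overline{\mathrm F}$D) $\left(\begin{pmatrix}\alpha_1&\mathbf{0}\\ \mathbf{0}&\alpha_8\end{pmatrix},\ \begin{pmatrix}\beta_1&\mathbf{0}\\ \mathbf{0}&\beta_8\end{pmatrix}\right)$ with $\alpha_1<\alpha_8$; ($\overline{\mathrm F}$K) $\left(\begin{pmatrix}\alpha_1&\mathbf{0}\\ \mathbf{0}&\alpha_8\end{pmatrix},\ \begin{pmatrix}\beta_1&(1,0,0)\\ \mathbf{0}&\beta_8\end{pmatrix}\right)$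 with $\alpha_1<\alpha_8$; ($\overline{\mathrm F}$K$^{\top}$) $\left(\begin{pmatrix}\alpha_1&\mathbf{0}\\ \mathbf{0}&\alpha_8\end{pmatrix},\ \begin{pmatrix}\beta_1&\mathbf{0}\\ (1,0,0)&\beta_8\end{pmatrix}\right)$ with $\alpha_1<\alpha_8$; ($\overline{\mathrm F}$N) $\left(\begin{pmatrix}\alpha_1&\mathbf{0}\\ \mathbf{0}&\alpha_8\end{pmatrix},\ \begin{pmatrix}\beta_1&(1,0,0)\\ (\beta_5,0,0)&\beta_8\end{pmatrix}\right)$ with $\alpha_1<\alpha_8$ and $\beta_5\neq 0$; ($\overline{\mathrm F}$P) $\left(\begin{pmatrix}\alpha_1&\mathbf{0}\\ \mathbf{0}&\alpha_8\end{pmatrix},\ \begin{pmatrix}\beta_1&(1,0,0)\\ (0,1,0)&\beta_8\end{pmatrix}\right)$ with $\alpha_1<\alpha_8$; (K$_1$E) $\left(\begin{pmatrix}\alpha_1&(1,0,0)\\ \mathbf{0}&\alpha_1\end{pmatrix},\ \beta_1 1_{\mathbf{O}}\right)$; (K$_1$F) $\left(\begin{pmatrix}\alpha_1&(1,0,0)\\ \mathbf{0}&\alpha_1\end{pmatrix},\ \begin{pmatrix}\beta_1&\mathbf{0}\\ \mathbf{0}&\beta_8\end{pmatrix}\right)$ with $\beta_1\neq\beta_8$; (K$_1$L$_1$) $\left(\begin{pmatrix}\alpha_1&(1,0,0)\\ \mathbf{0}&\alpha_1\end{pmatrix},\ \begin{pmatrix}\beta_1&(\beta_2,0,0)\\ \mathbf{0}&\beta_1\end{pmatrix}\right)$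 with $\beta_2\neq 0$; (K$_1\overline{\mathrm L}^{\top}$) $\left(\begin{pmatrix}\alpha_1&(1,0,0)\\ \mathbf{0}&\alpha_1\end{pmatrix},\ \begin{pmatrix}\beta_1&\mathbf{0}\\ (\beta_5,0,0)&\beta_8\end{pmatrix}\right)$ with $\beta_1\leq\beta_8$ and $\beta_5\neq 0$; (K$_1\overline{\mathrm M}$) $\left(\begin{pmatrix}\alpha_1&(1,0,0)\\ \mathbf{0}&\alpha_1\end{pmatrix},\ \begin{pmatrix}\beta_1&(0,1,0)\\ \mathbf{0}&\beta_8\end{pmatrix}\right)$ with $\beta_1\leq\beta_8$; (K$_1$M$_1^{\top}$) $\left(\begin{pmatrix}\alpha_1&(1,0,0)\\ \mathbf{0}&\alpha_1\end{pmatrix},\ \begin{pmatrix}\beta_1&\mathbf{0}\\ (0,1,0)&\beta_1\end{pmatrix}\right)$.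
   Context: $\mathbb{F}$ is an algebraically closed field of arbitrary characteristic. The octonion algebra $\mathbf{O}$ over $\mathbb{F}$ (split Cayley algebra) is the 8-dimensional $\mathbb{F}$-vector space of all formal matrices $a=\begin{pmatrix}\alpha&\mathbf{u}\\ \mathbf{v}&\beta\end{pmatrix}$ with $\alpha,\beta\in\mathbb{F}$, $\mathbf{u},\mathbf{v}\in\mathbb{F}^3$, with componentwise linear structure and multiplication $$\begin{pmatrix}\alpha&\mathbf{u}\\ \mathbf{v}&\beta\end{pmatrix}\begin{pmatrix}\alpha'&\mathbf{u}'\\ \mathbf{v}'&\beta'\end{pmatrix}=\begin{pmatrix}\alpha\alpha'+\mathbf{u}\cdot\mathbf{v}'&\alpha\mathbf{u}'+\beta'\mathbf{u}-\mathbf{v}\times\mathbf{v}'\\ \alpha'\mathbf{v}+\beta\mathbf{v}'+\mathbf{u}\times\mathbf{u}'&\beta\beta'+\mathbf{v}\cdot\mathbf{u}'\end{pmatrix},$$ where $\mathbf{u}\cdot\mathbf{v}=u_1v_1+u_2v_2+u_3v_3$ and $\mathbf{u}\times\mathbf{v}=(u_2v_3-u_3v_2,\,u_3v_1-u_1v_3,\,u_1v_2-u_2v_1)$. Here $\mathbf{0}=(0,0,0)$, and the unity is $1_{\mathbf{O}}=\begin{pmatrix}1&\mathbf{0}\\ \mathbf{0}&1\end{pmatrix}$. $\mathrm{G}_2=\mathrm{Aut}(\mathbf{O})$ is the group of all $\mathbb{F}$-algebra automorphisms of $\mathbf{O}$; it acts on $\mathbf{O}^2$ by $g(a,b)=(ga,gb)$.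 A binary relation $<$ on $\mathbb{F}$ is fixed such that $\alpha<\alpha$ never holds and for all $\alpha\neq\beta$ in $\mathbb{F}$ exactly one of $\alpha<\beta$, $\beta<\alpha$ holds; it is not assumed to be transitive or compatible with the field operations. $\alpha\leq\beta$ means $\alpha<\beta$ or $\alpha=\beta$. *)

theory Defs
  imports "HOL-Analysis.Cartesian_Space" "HOL-Computational_Algebra.Polynomial"
    "HOL-Algebra.Group_Action"
begin

text \<open>The library's dot and cross products are restricted to real vectors.\<close>

definition dot3 :: "'a::comm_ring_1 ^ 3 \<Rightarrow> 'a ^ 3 \<Rightarrow> 'a" where
  "dot3 u v = u $ 1 * v $ 1 + u $ 2 * v $ 2 + u $ 3 * v $ 3"

definition vprod3 :: "'a::comm_ring_1 ^ 3 \<Rightarrow> 'a ^ 3 \<Rightarrow> 'a ^ 3" where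
  "vprod3 u v = vector [u $ 2 * v $ 3 - u $ 3 * v $ 2,
                        u $ 3 * v $ 1 - u $ 1 * v $ 3,
                        u $ 1 * v $ 2 - u $ 2 * v $ 1]"

text \<open>\<open>Oct \<alpha> u v \<beta>\<close> is the formal matrix with first row \<open>\<alpha>, u\<close> and second row \<open>v, \<beta>\<close>.\<close>

datatype 'a octonion = Oct 'a "'a ^ 3" "'a ^ 3" 'a

instantiation octonion :: (comm_ring_1) ab_group_add
begin

definition zero_octonion :: "'a octonion" where
  "0 = Oct 0 0 0 0"

fun plus_octonion :: "'a octonion \<Rightarrow> 'a octonion \<Rightarrow> 'a octonion" where
  "Oct a u v b + Oct a' u' v' b' = Oct (a + a') (u + u') (v + v') (b + b')"

fun uminus_octonion :: "'a octonion \<Rightarrow> 'a octonion" where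
  "- Oct a u v b = Oct (- a) (- u) (- v) (- b)"

fun minus_octonion :: "'a octonion \<Rightarrow> 'a octonion \<Rightarrow> 'a octonion" where
  "Oct a u v b - Oct a' u' v' b' = Oct (a - a') (u - u') (v - v') (b - b')"

instance
proof
  fix x y z :: "'a octonion"
  show "x + y + z = x + (y + z)"
    by (cases x; cases y; cases z) (simp add: add.assoc)
  show "x + y = y + x"
    by (cases x; cases y) (simp add: add.commute)
  show "0 + x = x"
    by (cases x) (simp add: zero_octonion_def)
  show "- x + x = 0"
    by (cases x) (simp add: zero_octonion_def)
  show "x - y = x + - y"
    by (cases x; cases y) simp
qed

end

fun oct_scale :: "'a::comm_ring_1 \<Rightarrow> 'a octonion \<Rightarrow> 'a octonion" (infixr \<open>*\<^sub>O\<close> 75) where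
  "c *\<^sub>O Oct a u v b = Oct (c * a) (c *s u) (c *s v) (c * b)"

lemma vector_space_octonion: "vector_space (oct_scale :: 'a::field \<Rightarrow> _)"
proof
  fix c d :: 'a and x y :: "'a octonion"
  show "c *\<^sub>O (x + y) = c *\<^sub>O x + c *\<^sub>O y"
    by (cases x; cases y) (simp add: vec_eq_iff algebra_simps)
  show "(c + d) *\<^sub>O x = c *\<^sub>O x + d *\<^sub>O x"
    by (cases x) (simp add: vec_eq_iff algebra_simps)
  show "c *\<^sub>O (d *\<^sub>O x) = (c * d) *\<^sub>O x"
    by (cases x) (simp add: vec_eq_iff algebra_simps)
  show "1 *\<^sub>O x = x"
    by (cases x) (simp add: vec_eq_iff)
qed

instantiation octonion :: (comm_ring_1) "{one, times}"
begin

definition one_octonion :: "'a octonion" where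
  "1 = Oct 1 0 0 1"

fun times_octonion :: "'a octonion \<Rightarrow> 'a octonion \<Rightarrow> 'a octonion" where
  "Oct a u v b * Oct a' u' v' b' =
     Oct (a * a' + dot3 u v')
         (a *s u' + b' *s u - vprod3 v v')
         (a' *s v + b *s v' + vprod3 u u')
         (b * b' + dot3 v u')"

instance ..

end

lemma octonion_unity:
  fixes x :: "'a::comm_ring_1 octonion"
  shows "1 * x = x" "x * 1 = x"
  by (cases x; simp add: one_octonion_def dot3_def vprod3_def vec_eq_iff forall_3)+

definition oct_aut :: "('a::field octonion \<Rightarrow> 'a octonion) set" where
  "oct_aut = {g. bij g \<and> Vector_Spaces.linear oct_scale oct_scale g \<and>
                 (\<forall>x y. g (x * y) = g x * g y)}"

definition G2 :: "('a::field octonion \<Rightarrow> 'a octonion) monoid" where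
  "G2 = (BijGroup UNIV)\<lparr>carrier := oct_aut\<rparr>"

lemma Bij_UNIV: "Bij UNIV = {f. bij f}"
  by (auto simp: Bij_def extensional_def)

lemma compose_UNIV: "compose UNIV f g = f \<circ> g"
  by (simp add: compose_def fun_eq_iff)

lemma restrict_UNIV: "restrict f UNIV = f"
  by (simp add: fun_eq_iff)

lemma oct_aut_iff:
  "g \<in> oct_aut \<longleftrightarrow> bij g \<and> (\<forall>x y. g (x + y) = g x + g y) \<and>
     (\<forall>c x. g (c *\<^sub>O x) = c *\<^sub>O g x) \<and> (\<forall>x y. g (x * y) = g x * g y)"
  by (simp add: oct_aut_def linear_iff_module_hom module_hom_iff
      vector_space_octonion module_iff_vector_space)

lemma oct_aut_inv:
  assumes "g \<in> oct_aut"
  shows "inv_into UNIV g \<in> oct_aut"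
proof -
  have g: "bij g" "\<And>x y. g (x + y) = g x + g y"
    "\<And>c x. g (c *\<^sub>O x) = c *\<^sub>O g x" "\<And>x y. g (x * y) = g x * g y"
    using assms by (auto simp: oct_aut_iff)
  have s: "\<And>x. g (inv_into UNIV g x) = x"
    using g(1) by (simp add: bij_is_surj surj_f_inv_f)
  have e: "\<And>x y. inv_into UNIV g x = y \<longleftrightarrow> x = g y"
    using g(1) s by (metis bij_inv_eq_iff)
  show ?thesis
    unfolding oct_aut_iff using g s by (simp add: e bij_imp_bij_inv)
qed

lemma subgroup_oct_aut: "subgroup oct_aut (BijGroup (UNIV :: 'a::field octonion set))"
proof (rule group.subgroupI[OF group_BijGroup])
  show "oct_aut \<subseteq> carrier (BijGroup (UNIV :: 'a octonion set))"
    by (auto simp: BijGroup_def Bij_UNIV oct_aut_iff)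
  have "id \<in> (oct_aut :: ('a octonion \<Rightarrow> _) set)"
    by (simp add: oct_aut_iff)
  then show "(oct_aut :: ('a octonion \<Rightarrow> _) set) \<noteq> {}"
    by blast
next
  fix g :: "'a octonion \<Rightarrow> 'a octonion"
  assume g: "g \<in> oct_aut"
  then have "g \<in> Bij UNIV"
    by (simp add: Bij_UNIV oct_aut_iff)
  then show "inv\<^bsub>BijGroup UNIV\<^esub> g \<in> oct_aut"
    using oct_aut_inv[OF g] by (simp add: inv_BijGroup restrict_UNIV)
next
  fix g h :: "'a octonion \<Rightarrow> 'a octonion"
  assume "g \<in> oct_aut" "h \<in> oct_aut"
  then show "g \<otimes>\<^bsub>BijGroup UNIV\<^esub> h \<in> oct_aut"
    by (auto simp: BijGroup_def Bij_UNIV compose_UNIV oct_aut_iff bij_comp)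
qed

lemma group_G2: "group G2"
  unfolding G2_def
  by (rule subgroup.subgroup_is_group[OF subgroup_oct_aut group_BijGroup])

definition diag_act :: "('a octonion \<Rightarrow> 'a octonion) \<Rightarrow> 'a octonion \<times> 'a octonion
    \<Rightarrow> 'a octonion \<times> 'a octonion" where
  "diag_act g = (\<lambda>(a, b). (g a, g b))"

lemma group_action_G2:
  "group_action G2 (UNIV :: ('a::field octonion \<times> 'a octonion) set) diag_act"
proof -
  have b: "bij (diag_act g)" if "bij g" for g :: "'a octonion \<Rightarrow> 'a octonion"
    using bij_betw_map_prod[OF that that]
    by (simp add: diag_act_def map_prod_def)
  have "diag_act \<in> hom G2 (BijGroup (UNIV :: ('a octonion \<times> 'a octonion) set))"
    by (auto simp: hom_def G2_def BijGroup_def Bij_UNIV compose_UNIV oct_aut_iff b)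
      (auto simp: diag_act_def fun_eq_iff)
  then show ?thesis
    unfolding group_action_def group_hom_def group_hom_axioms_def
    using group_G2 group_BijGroup by blast
qed

text \<open>
  The rule names follow the labels of the families: a trailing \<open>b\<close> stands for an
  overline and a trailing \<open>T\<close> for a transpose.
\<close>

inductive_set pair_reps :: "('a::field \<Rightarrow> 'a \<Rightarrow> bool) \<Rightarrow> ('a octonion \<times> 'a octonion) set"
  for lt :: "'a \<Rightarrow> 'a \<Rightarrow> bool"
where
  E_E: "(\<alpha>1 *\<^sub>O 1, \<beta>1 *\<^sub>O 1) \<in> pair_reps lt"
| E_Fb: "lt \<beta>1 \<beta>8 \<Longrightarrow>
    (\<alpha>1 *\<^sub>O 1, Oct \<beta>1 0 0 \<beta>8) \<in> pair_reps lt"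
| E_K1: "(\<alpha>1 *\<^sub>O 1, Oct \<beta>1 (vector [1, 0, 0]) 0 \<beta>1) \<in> pair_reps lt"
| Fb_D: "lt \<alpha>1 \<alpha>8 \<Longrightarrow>
    (Oct \<alpha>1 0 0 \<alpha>8, Oct \<beta>1 0 0 \<beta>8) \<in> pair_reps lt"
| Fb_K: "lt \<alpha>1 \<alpha>8 \<Longrightarrow>
    (Oct \<alpha>1 0 0 \<alpha>8, Oct \<beta>1 (vector [1, 0, 0]) 0 \<beta>8) \<in> pair_reps lt"
| Fb_KT: "lt \<alpha>1 \<alpha>8 \<Longrightarrow>
    (Oct \<alpha>1 0 0 \<alpha>8, Oct \<beta>1 0 (vector [1, 0, 0]) \<beta>8) \<in> pair_reps lt"
| Fb_N: "lt \<alpha>1 \<alpha>8 \<Longrightarrow> \<beta>5 \<noteq> 0 \<Longrightarrow>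
    (Oct \<alpha>1 0 0 \<alpha>8, Oct \<beta>1 (vector [1, 0, 0]) (vector [\<beta>5, 0, 0]) \<beta>8) \<in> pair_reps lt"
| Fb_P: "lt \<alpha>1 \<alpha>8 \<Longrightarrow>
    (Oct \<alpha>1 0 0 \<alpha>8, Oct \<beta>1 (vector [1, 0, 0]) (vector [0, 1, 0]) \<beta>8) \<in> pair_reps lt"
| K1_E: "(Oct \<alpha>1 (vector [1, 0, 0]) 0 \<alpha>1, \<beta>1 *\<^sub>O 1) \<in> pair_reps lt"
| K1_F: "\<beta>1 \<noteq> \<beta>8 \<Longrightarrow>
    (Oct \<alpha>1 (vector [1, 0, 0]) 0 \<alpha>1, Oct \<beta>1 0 0 \<beta>8) \<in> pair_reps lt"
| K1_L1: "\<beta>2 \<noteq> 0 \<Longrightarrow>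
    (Oct \<alpha>1 (vector [1, 0, 0]) 0 \<alpha>1, Oct \<beta>1 (vector [\<beta>2, 0, 0]) 0 \<beta>1) \<in> pair_reps lt"
| K1_LbT: "lt \<beta>1 \<beta>8 \<or> \<beta>1 = \<beta>8 \<Longrightarrow> \<beta>5 \<noteq> 0 \<Longrightarrow>
    (Oct \<alpha>1 (vector [1, 0, 0]) 0 \<alpha>1, Oct \<beta>1 0 (vector [\<beta>5, 0, 0]) \<beta>8) \<in> pair_reps lt"
| K1_Mb: "lt \<beta>1 \<beta>8 \<or> \<beta>1 = \<beta>8 \<Longrightarrow>
    (Oct \<alpha>1 (vector [1, 0, 0]) 0 \<alpha>1, Oct \<beta>1 (vector [0, 1, 0]) 0 \<beta>8) \<in> pair_reps lt"
| K1_M1T: "(Oct \<alpha>1 (vector [1, 0, 0]) 0 \<alpha>1, Oct \<beta>1 0 (vector [0, 1, 0]) \<beta>1) \<in> pair_reps lt"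

end

theory Submission
  imports Defs
begin

text \<open>
  The automorphism group contains the volume preserving changes of coordinates of \<open>F\<^sup>3\<close>,
  the map exchanging the two idempotents, and unipotent maps moving the idempotent
  \<open>Oct 1 0 0 0\<close>. Solving quadratic equations for the parameters of the unipotent maps brings a
  single octonion into scalar, diagonal or (scalar plus nilpotent) form; the explicit maps that
  stabilise this form then suffice to normalise the second octonion.

  Conversely, trace and norm are preserved, since every octonion satisfies its
  characteristic equation. They determine the first component. An automorphism fixing a
  nonscalar diagonal element preserves the Peirce components with respect to
  \<open>Oct 1 0 0 0\<close>; one fixing \<open>Oct \<alpha> (vector [1, 0, 0]) 0 \<alpha>\<close> fixes its nilpotent part \<open>x\<close>,
  and the second component \<open>b\<close> is recovered from trace, norm, the trace of \<open>x * b\<close>, and linear relations among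
  \<open>1\<close>, \<open>x\<close>, \<open>b\<close>, \<open>x * b\<close> and \<open>b * x\<close>.
\<close>

section \<open>Cross products\<close>

lemmas vec3_simps = dot3_def vprod3_def vec_eq_iff forall_3

lemma dot3_surj:
  fixes p :: "'a::field ^ 3"
  assumes "p \<noteq> 0"
  obtains q where "dot3 q p = 1"
proof -
  from assms consider "p $ 1 \<noteq> 0" | "p $ 2 \<noteq> 0" | "p $ 3 \<noteq> 0"
    by (auto simp: vec3_simps)
  then show thesis
  proof cases
    case 1
    then show ?thesis by (intro that[of "vector [1 / p $ 1, 0, 0]"]) (simp add: dot3_def)
  next
    case 2
    then show ?thesis by (intro that[of "vector [0, 1 / p $ 2, 0]"]) (simp add: dot3_def)
  next
    case 3
    then show ?thesis by (intro that[of "vector [0, 0, 1 / p $ 3]"]) (simp add: dot3_def)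
  qed
qed

text \<open>For \<open>p \<noteq> 0\<close> the image of \<open>\<lambda>r. vprod3 r p\<close> is
  the orthogonal complement of \<open>p\<close>. Preimages differ by multiples of \<open>p\<close>,
  so the coordinate of \<open>r\<close> at a nonzero entry of \<open>p\<close> can be set to 0; the
  other two are then solved for.\<close>

lemma vprod3_left_surj:
  fixes p v :: "'a::field ^ 3"
  assumes "p \<noteq> 0" and "dot3 p v = 0"
  obtains r where "vprod3 r p = v"
proof -
  from \<open>p \<noteq> 0\<close> consider "p $ 1 \<noteq> 0" | "p $ 2 \<noteq> 0" | "p $ 3 \<noteq> 0"
    by (auto simp: vec3_simps)
  then show thesis
  proof cases
    case 1
    with assms(2) show ?thesis
      by (intro that[of "vector [0, - v $ 3 / p $ 1, v $ 2 / p $ 1]"])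
        (simp add: vec3_simps divide_simps, algebra)
  next
    case 2
    with assms(2) show ?thesis
      by (intro that[of "vector [v $ 3 / p $ 2, 0, - v $ 1 / p $ 2]"])
        (simp add: vec3_simps divide_simps, algebra)
  next
    case 3
    with assms(2) show ?thesis
      by (intro that[of "vector [- v $ 2 / p $ 3, v $ 1 / p $ 3, 0]"])
        (simp add: vec3_simps divide_simps, algebra)
  qed
qed

text \<open>Any nonzero vector orthogonal to \<open>v\<close> can serve as the factor
  \<open>r\<close>. This realises a prescribed vector as a member of a dual basis when a unimodular
  basis is completed.\<close>

lemma vprod3_surj:
  fixes v :: "'a::field ^ 3"
  assumes "v \<noteq> 0"
  obtains q r where "vprod3 q r = v"
proof -
  from assms consider "v $ 1 = 0" | "v $ 1 \<noteq> 0"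
    by blast
  then show thesis
  proof cases
    case 1
    have "vector [1, 0, 0] \<noteq> (0 :: 'a ^ 3)"
      by (simp add: vec3_simps)
    moreover from 1 have "dot3 (vector [1, 0, 0]) v = 0"
      by (simp add: dot3_def)
    ultimately show ?thesis
      by (rule vprod3_left_surj) (rule that)
  next
    case 2
    have "vector [- v $ 2, v $ 1, 0] \<noteq> (0 :: 'a ^ 3)"
      using 2 by (simp add: vec3_simps)
    moreover have "dot3 (vector [- v $ 2, v $ 1, 0]) v = 0"
      by (simp add: dot3_def)
    ultimately show ?thesis
      by (rule vprod3_left_surj) (rule that)
  qed
qed

text \<open>Cyclic invariance of the determinant: unimodularity can be read off from whichever cross
  product is known.\<close>

lemma triple_product_rotate: "dot3 p (vprod3 q r) = dot3 q (vprod3 r p)"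
  by (simp add: dot3_def vprod3_def algebra_simps)

lemma dot3_commute: "dot3 u v = dot3 v u"
  by (simp add: dot3_def mult.commute)

lemma dot3_vprod3_self [simp]:
  "dot3 p (vprod3 p q) = 0" "dot3 q (vprod3 p q) = 0"
  by (simp_all add: dot3_def vprod3_def algebra_simps)

lemma dot3_zero [simp]: "dot3 0 v = 0" "dot3 v 0 = 0"
  by (simp_all add: dot3_def)

lemma vprod3_zero [simp]: "vprod3 0 v = 0" "vprod3 v 0 = 0"
  by (simp_all add: vec3_simps)

lemma dot3_scale [simp]: "dot3 (c *s u) v = c * dot3 u v" "dot3 u (c *s v) = c * dot3 u v"
  by (simp_all add: dot3_def algebra_simps)

lemma dot3_vprod3_self' [simp]:
  "dot3 (vprod3 p q) p = 0" "dot3 (vprod3 p q) q = 0"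
  by (simp_all add: dot3_def vprod3_def algebra_simps)

lemma vprod3_scale_self [simp]: "vprod3 (c *s u) u = 0"
  by (simp add: vec3_simps algebra_simps)

lemma vector3_eq_0_iff [simp]: "vector [x, y, z] = (0 :: 'a::zero ^ 3) \<longleftrightarrow> x = 0 \<and> y = 0 \<and> z = 0"
  by (simp add: vec_eq_iff forall_3)

lemma vector3_eq_iff [simp]:
  "vector [x, y, z] = (vector [x', y', z'] :: 'a::zero ^ 3) \<longleftrightarrow> x = x' \<and> y = y' \<and> z = z'"
  by (simp add: vec_eq_iff forall_3)

section \<open>Automorphisms of the octonions\<close>

lemma oct_autI:
  assumes "\<And>x. h (g x) = x" "\<And>x. g (h x) = x"
    and "\<And>x y. g (x + y) = g x + g y" "\<And>c x. g (c *\<^sub>O x) = c *\<^sub>O g x"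
    and "\<And>x y. g (x * y) = g x * g y"
  shows "g \<in> oct_aut"
  using assms o_bij[of h g] by (auto simp: oct_aut_iff fun_eq_iff)

text \<open>
  For a unimodular basis \<open>p, q, r\<close>, the basis dual to it is formed by the cross products.
\<close>

fun coord_map :: "'a::field ^ 3 \<Rightarrow> 'a ^ 3 \<Rightarrow> 'a ^ 3 \<Rightarrow> 'a octonion \<Rightarrow> 'a octonion" where
  "coord_map p q r (Oct a u v b) =
     Oct a (vector [dot3 u (vprod3 q r), dot3 u (vprod3 r p), dot3 u (vprod3 p q)])
       (vector [dot3 v p, dot3 v q, dot3 v r]) b"

fun coord_map_inv :: "'a::field ^ 3 \<Rightarrow> 'a ^ 3 \<Rightarrow> 'a ^ 3 \<Rightarrow> 'a octonion \<Rightarrow> 'a octonion" where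
  "coord_map_inv p q r (Oct a u v b) =
     Oct a (u $ 1 *s p + u $ 2 *s q + u $ 3 *s r)
       (v $ 1 *s vprod3 q r + v $ 2 *s vprod3 r p + v $ 3 *s vprod3 p q) b"

lemma coord_map_oct_aut:
  fixes p q r :: "'a::field ^ 3"
  assumes det: "dot3 p (vprod3 q r) = 1"
  shows "coord_map p q r \<in> oct_aut"
proof (rule oct_autI[of "coord_map_inv p q r"])
  \<comment> \<open>\<open>?A u\<close> lists the coordinates of \<open>u\<close> in the basis
    \<open>p, q, r\<close>, and \<open>?B v\<close> those of \<open>v\<close> in the dual basis. The
    identities below are polynomial, with the determinant \<open>?d\<close> as an explicit factor
    where it occurs; \<open>det\<close> is inserted only afterwards.\<close>
  let ?A = "\<lambda>u :: 'a ^ 3. vector [dot3 u (vprod3 q r), dot3 u (vprod3 r p), dot3 u (vprod3 p q)] :: 'a ^ 3"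
  let ?B = "\<lambda>v :: 'a ^ 3. vector [dot3 v p, dot3 v q, dot3 v r] :: 'a ^ 3"
  let ?d = "dot3 p (vprod3 q r)"
  have dot: "dot3 (?A u) (?B v) = ?d * dot3 u v" for u v
    by (simp add: dot3_def vprod3_def) algebra
  have AA: "vprod3 (?A u) (?A v) = ?d *s ?B (vprod3 u v)" for u v
    by (simp add: vec3_simps; intro conjI; algebra)
  have BB: "vprod3 (?B u) (?B v) = ?A (vprod3 u v)" for u v
    by (simp add: vec3_simps; intro conjI; algebra)
  \<comment> \<open>The arguments in \<open>A\<close> and \<open>B\<close> have the shape of the
    upper and lower vector entries of a product of octonions.\<close>
  have A: "?A (x *s u + y *s v - z) = x *s ?A u + y *s ?A v - ?A z" for x y u v z
    by (simp add: vec3_simps; intro conjI; algebra)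
  have B: "?B (x *s u + y *s v + z) = x *s ?B u + y *s ?B v + ?B z" for x y u v z
    by (simp add: vec3_simps; intro conjI; algebra)
  fix x y :: "'a octonion" and c :: 'a
  show "coord_map p q r (x + y) = coord_map p q r x + coord_map p q r y"
    by (cases x; cases y) (simp add: vec3_simps algebra_simps)
  show "coord_map p q r (c *\<^sub>O x) = c *\<^sub>O coord_map p q r x"
    by (cases x) (simp add: vec3_simps algebra_simps)
  obtain a u v b where x: "x = Oct a u v b" by (cases x)
  obtain a' u' v' b' where y: "y = Oct a' u' v' b'" by (cases y)
  have dot': "dot3 (?B v) (?A u) = dot3 v u" for u v
    using dot[of u v] det by (simp add: dot3_commute)
  show "coord_map p q r (x * y) = coord_map p q r x * coord_map p q r y"
    unfolding x y times_octonion.simps coord_map.simps A B AA BB dot dot' det by simp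
  have "?d *s u = (?A u) $ 1 *s p + (?A u) $ 2 *s q + (?A u) $ 3 *s r" for u
    by (simp add: vec3_simps; intro conjI; algebra)
  then have 1: "(?A u) $ 1 *s p + (?A u) $ 2 *s q + (?A u) $ 3 *s r = u" for u
    by (metis det vector_scalar_mult_def vector_smult_lid)
  have "?d *s v = (?B v) $ 1 *s vprod3 q r + (?B v) $ 2 *s vprod3 r p + (?B v) $ 3 *s vprod3 p q" for v
    by (simp add: vec3_simps; intro conjI; algebra)
  then have 2: "(?B v) $ 1 *s vprod3 q r + (?B v) $ 2 *s vprod3 r p + (?B v) $ 3 *s vprod3 p q = v" for v
    by (metis det vector_smult_lid)
  show "coord_map_inv p q r (coord_map p q r x) = x"
    unfolding x coord_map.simps coord_map_inv.simps 1 2 ..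
  have "?A (u $ 1 *s p + u $ 2 *s q + u $ 3 *s r) = ?d *s u" for u
    by (simp add: vec3_simps; intro conjI; algebra)
  moreover have "?B (v $ 1 *s vprod3 q r + v $ 2 *s vprod3 r p + v $ 3 *s vprod3 p q) = ?d *s v" for v
    by (simp add: vec3_simps; intro conjI; algebra)
  ultimately show "coord_map p q r (coord_map_inv p q r x) = x"
    unfolding x by (simp add: det)
qed

text \<open>The minus signs compensate the opposite signs of the two cross products in the
  multiplication.\<close>

fun swap_map :: "'a::field octonion \<Rightarrow> 'a octonion" where
  "swap_map (Oct a u v b) = Oct b (- v) (- u) a"

lemma swap_map_oct_aut: "swap_map \<in> oct_aut"
proof (rule oct_autI[of swap_map])
  fix x y :: "'a octonion" and c :: 'a
  show "swap_map (swap_map x) = x" "swap_map (swap_map x) = x"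
    by (cases x; simp)+
  show "swap_map (x + y) = swap_map x + swap_map y"
    by (cases x; cases y) simp
  show "swap_map (c *\<^sub>O x) = c *\<^sub>O swap_map x"
    by (cases x) (simp add: vec3_simps)
  show "swap_map (x * y) = swap_map x * swap_map y"
    by (cases x; cases y) (simp add: vec3_simps algebra_simps)
qed

text \<open>
  These maps send the idempotent \<open>Oct 1 0 0 0\<close> to \<open>Oct 1 w 0 0\<close>, respectively
  \<open>Oct 1 0 w 0\<close>; the other entries are forced by the Peirce decomposition with respect
  to the new idempotent.
\<close>

fun upper_map :: "'a::field ^ 3 \<Rightarrow> 'a octonion \<Rightarrow> 'a octonion" where
  "upper_map w (Oct a u v b) =
     Oct (a - dot3 w v) (u + (a - b - dot3 w v) *s w) (v + vprod3 w u) (b + dot3 w v)"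

fun lower_map :: "'a::field ^ 3 \<Rightarrow> 'a octonion \<Rightarrow> 'a octonion" where
  "lower_map w (Oct a u v b) =
     Oct (a - dot3 w u) (u + vprod3 w v) (v + (a - b - dot3 w u) *s w) (b + dot3 w u)"

lemma upper_map_oct_aut: "upper_map w \<in> oct_aut"
proof (rule oct_autI[of "upper_map (- w)"])
  fix x y :: "'a octonion" and c :: 'a
  show "upper_map (- w) (upper_map w x) = x"
    by (cases x) (simp add: vec3_simps algebra_simps)
  show "upper_map w (upper_map (- w) x) = x"
    by (cases x) (simp add: vec3_simps algebra_simps)
  show "upper_map w (x + y) = upper_map w x + upper_map w y"
    by (cases x; cases y) (simp add: vec3_simps algebra_simps)
  show "upper_map w (c *\<^sub>O x) = c *\<^sub>O upper_map w x"
    by (cases x) (simp add: vec3_simps algebra_simps)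
  obtain a u v b where x: "x = Oct a u v b" by (cases x)
  obtain a' u' v' b' where y: "y = Oct a' u' v' b'" by (cases y)
  show "upper_map w (x * y) = upper_map w x * upper_map w y"
    unfolding x y by (simp add: vec3_simps; intro conjI; algebra)
qed

lemma oct_aut_comp:
  assumes "g \<in> oct_aut" "h \<in> oct_aut"
  shows "g \<circ> h \<in> oct_aut"
  using assms by (auto simp: oct_aut_iff bij_comp)

text \<open>Conjugation by \<open>swap_map\<close> turns \<open>upper_map w\<close> into
  \<open>lower_map w\<close>, with the same parameter.\<close>

lemma lower_map_oct_aut: "lower_map w \<in> oct_aut"
proof -
  have "lower_map w x = (swap_map \<circ> upper_map w \<circ> swap_map) x" for x
    by (cases x) (simp add: vec3_simps algebra_simps)
  then have "lower_map w = swap_map \<circ> upper_map w \<circ> swap_map"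
    by blast
  then show ?thesis
    by (simp add: oct_aut_comp swap_map_oct_aut upper_map_oct_aut)
qed

lemma scalar_octonion [simp]: "c *\<^sub>O 1 = Oct c 0 0 c"
  by (simp add: one_octonion_def vec_eq_iff)

context
  fixes g :: "'a::field octonion \<Rightarrow> 'a octonion"
  assumes g: "g \<in> oct_aut"
begin

lemma oct_aut_add: "g (x + y) = g x + g y"
  and oct_aut_scale: "g (c *\<^sub>O x) = c *\<^sub>O g x"
  and oct_aut_mult: "g (x * y) = g x * g y"
  and oct_aut_eq_iff: "g x = g y \<longleftrightarrow> x = y"
  using g by (auto simp: oct_aut_iff bij_def inj_eq)

lemma oct_aut_diff: "g (x - y) = g x - g y"
  using oct_aut_add[of "x - y" y] by (simp add: algebra_simps)

lemma oct_aut_one: "g 1 = 1"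
  using g octonion_unity by (metis oct_aut_iff bij_iff)

lemma oct_aut_scalar: "g (Oct c 0 0 c) = Oct c 0 0 c"
  using oct_aut_scale[of c 1] by (simp add: oct_aut_one)

lemma oct_aut_eq_scalar_iff: "g x = Oct c 0 0 c \<longleftrightarrow> x = Oct c 0 0 c"
  using oct_aut_eq_iff oct_aut_scalar by metis

end

section \<open>Normal forms\<close>

text \<open>This quadratic in \<open>t\<close> describes a vector entry after a unipotent map with
  parameter proportional to \<open>t\<close>: \<open>d\<close> is the difference of the diagonal
  entries and \<open>s\<close> a dot product. Algebraic closedness enters here.\<close>

lemma quadratic_root:
  fixes c d s :: "'a::alg_closed_field"
  assumes "s \<noteq> 0"
  obtains t where "c + (d - t * s) * t = 0"
proof -
  have "degree [:c, d, - s:] > 0"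
    using assms by simp
  then obtain t where "poly [:c, d, - s:] t = 0"
    using alg_closed_imp_poly_has_root by blast
  then show thesis
    by (intro that[of t]) (simp add: algebra_simps)
qed

section \<open>Representatives of the orbits on single octonions\<close>

locale tournament =
  fixes lt :: "'a::alg_closed_field \<Rightarrow> 'a \<Rightarrow> bool"
  assumes irrefl: "\<not> lt \<alpha> \<alpha>"
    and total: "\<alpha> \<noteq> \<beta> \<Longrightarrow> (lt \<alpha> \<beta> \<and> \<not> lt \<beta> \<alpha>) \<or> (lt \<beta> \<alpha> \<and> \<not> lt \<alpha> \<beta>)"

text \<open>These are the first components occurring in \<open>pair_reps\<close>, and also the
  second components that go with a scalar first one.\<close>

inductive_set oct_reps :: "('a::field \<Rightarrow> 'a \<Rightarrow> bool) \<Rightarrow> 'a octonion set"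
  for lt :: "'a \<Rightarrow> 'a \<Rightarrow> bool"
where
  Scalar: "Oct \<alpha> 0 0 \<alpha> \<in> oct_reps lt"
| Diagonal: "lt \<alpha> \<beta> \<Longrightarrow> Oct \<alpha> 0 0 \<beta> \<in> oct_reps lt"
| Nilpotent: "Oct \<alpha> (vector [1, 0, 0]) 0 \<alpha> \<in> oct_reps lt"

context tournament
begin

text \<open>A unipotent map removes one vector entry: if \<open>dot3 u v = 0\<close> and
  \<open>u \<noteq> 0\<close>, a cross product with \<open>u\<close> cancels \<open>v\<close>; if
  \<open>dot3 u v \<noteq> 0\<close>, a quadratic root makes \<open>u\<close> vanish. The resulting
  triangular octonion is diagonalised when its diagonal entries differ; otherwise a coordinate
  change normalises its vector entry.\<close>

lemma oct_normal_form: "\<exists>g\<in>oct_aut. g a \<in> oct_reps lt"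
proof -
  define R where "R a \<longleftrightarrow> (\<exists>g\<in>oct_aut. g a \<in> oct_reps lt)" for a
  have RI: "R a" if "a \<in> oct_reps lt" for a
    unfolding R_def using that by (intro bexI[of _ id]) (simp_all add: oct_aut_iff)
  have step: "R a" if g: "g \<in> oct_aut" "g a = b" and "R b" for g a b
  proof -
    from \<open>R b\<close> obtain h where "h \<in> oct_aut" "h b \<in> oct_reps lt"
      unfolding R_def by blast
    with g show ?thesis
      unfolding R_def by (intro bexI[of _ "h \<circ> g"]) (simp_all add: oct_aut_comp)
  qed
  have diag: "R (Oct \<alpha> 0 0 \<beta>)" for \<alpha> \<beta>
  proof -
    consider "\<alpha> = \<beta>" | "lt \<alpha> \<beta>" | "lt \<beta> \<alpha>"
      using total by blast
    then show ?thesis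
    proof cases
      case 3
      then have "R (Oct \<beta> 0 0 \<alpha>)"
        by (intro RI oct_reps.intros)
      then show ?thesis
        by (rule step[OF swap_map_oct_aut, rotated]) simp
    qed (auto intro: RI oct_reps.intros)
  qed
  have upper: "R (Oct \<alpha> u 0 \<beta>)" for \<alpha> u \<beta>
  proof (cases "\<alpha> = \<beta>")
    case False
    have "upper_map ((1 / (\<beta> - \<alpha>)) *s u) (Oct \<alpha> u 0 \<beta>) = Oct \<alpha> 0 0 \<beta>"
      using False by (simp add: vec_eq_iff field_simps)
    then show ?thesis
      using diag by (rule step[OF upper_map_oct_aut])
  next
    case True
    show ?thesis
    proof (cases "u = 0")
      case True
      then show ?thesis
        using diag by simp
    next
      case False
      \<comment> \<open>Writing \<open>v\<close> as \<open>vprod3 q r\<close> completes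
        \<open>u\<close> to a unimodular basis, in which \<open>u\<close> is the first basis
        vector.\<close>
      then obtain v where v: "dot3 v u = 1"
        by (rule dot3_surj)
      then have "v \<noteq> 0"
        by auto
      then obtain q r where qr: "vprod3 q r = v"
        by (rule vprod3_surj)
      have det: "dot3 u (vprod3 q r) = 1"
        using v qr by (simp add: dot3_commute)
      then have "coord_map u q r (Oct \<alpha> u 0 \<beta>) = Oct \<alpha> (vector [1, 0, 0]) 0 \<beta>"
        by simp
      moreover have "R (Oct \<alpha> (vector [1, 0, 0]) 0 \<beta>)"
        using \<open>\<alpha> = \<beta>\<close> by (auto intro: RI oct_reps.intros)
      ultimately show ?thesis
        by (rule step[OF coord_map_oct_aut[OF det]])
    qed
  qed
  have lower: "R (Oct \<alpha> 0 v \<beta>)" for \<alpha> v \<beta>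
    using upper[of \<beta> "- v" \<alpha>] by (rule step[OF swap_map_oct_aut, rotated]) simp
  obtain \<alpha> u v \<beta> where a: "a = Oct \<alpha> u v \<beta>"
    by (cases a)
  consider "u = 0" | "u \<noteq> 0" "dot3 u v = 0" | "dot3 u v \<noteq> 0"
    by blast
  then have "R a"
  proof cases
    case 1
    then show ?thesis
      using lower a by simp
  next
    case 2
    moreover have "dot3 u (- v) = - dot3 u v"
      by (simp add: dot3_def)
    ultimately obtain w where w: "vprod3 w u = - v"
      using vprod3_left_surj[of u "- v"] by auto
    then have "upper_map w a = Oct (\<alpha> - dot3 w v) (u + (\<alpha> - \<beta> - dot3 w v) *s w) 0 (\<beta> + dot3 w v)"
      by (simp add: a)
    then show ?thesis
      using upper by (rule step[OF upper_map_oct_aut])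
  next
    case 3
    \<comment> \<open>For the parameter \<open>c *s u\<close> the cross product with
      \<open>u\<close> vanishes, so \<open>v\<close> is kept and \<open>u\<close> is multiplied by
      this expression.\<close>
    then obtain c where c: "1 + (\<alpha> - \<beta> - c * dot3 u v) * c = 0"
      by (rule quadratic_root)
    have "u + (\<alpha> - \<beta> - c * dot3 u v) *s (c *s u) = (1 + (\<alpha> - \<beta> - c * dot3 u v) * c) *s u"
      by (simp add: vec_eq_iff algebra_simps)
    then have "upper_map (c *s u) a = Oct (\<alpha> - c * dot3 u v) 0 v (\<beta> + c * dot3 u v)"
      using c by (simp add: a)
    then show ?thesis
      using lower by (rule step[OF upper_map_oct_aut])
  qed
  then show ?thesis
    unfolding R_def .
qed

section \<open>Existence of representatives for pairs, by the type of the first component\<close>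

definition represented :: "'a octonion \<Rightarrow> 'a octonion \<Rightarrow> bool" where
  "represented a b \<longleftrightarrow> (\<exists>g\<in>oct_aut. (g a, g b) \<in> pair_reps lt)"

lemma representedI: "(a, b) \<in> pair_reps lt \<Longrightarrow> represented a b"
  unfolding represented_def by (intro bexI[of _ id]) (simp_all add: oct_aut_iff)

lemma represented_step:
  assumes g: "g \<in> oct_aut" "g a = a'" "g b = b'" and "represented a' b'"
  shows "represented a b"
proof -
  from \<open>represented a' b'\<close> obtain h where "h \<in> oct_aut" "(h a', h b') \<in> pair_reps lt"
    unfolding represented_def by blast
  with g show ?thesis
    unfolding represented_def by (intro bexI[of _ "h \<circ> g"]) (simp_all add: oct_aut_comp)
qed

lemma represented_scalar: "represented (Oct \<alpha> 0 0 \<alpha>) b"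
proof -
  obtain g where g: "g \<in> oct_aut" "g b \<in> oct_reps lt"
    using oct_normal_form by blast
  have "(Oct \<alpha> 0 0 \<alpha>, g b) \<in> pair_reps lt"
    using g(2) pair_reps.intros(1-3)[where ?\<alpha>1.0 = \<alpha> and lt = lt] by cases auto
  then show ?thesis
    using g(1) oct_aut_scalar[OF g(1)] unfolding represented_def by (intro bexI[of _ g]) simp_all
qed

text \<open>Coordinate changes fix every diagonal octonion and act on \<open>u\<close> and
  \<open>v\<close> as on a vector and a covector of the special linear group. In each case a basis
  adapted to \<open>u\<close> and \<open>v\<close> gives the normal form.\<close>

lemma represented_diagonal:
  assumes "lt \<alpha> \<beta>"
  shows "represented (Oct \<alpha> 0 0 \<beta>) b"
proof -
  obtain \<gamma> u v \<delta> where b: "b = Oct \<gamma> u v \<delta>"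
    by (cases b)
  note R = representedI[OF pair_reps.Fb_D, OF assms] representedI[OF pair_reps.Fb_K, OF assms]
    representedI[OF pair_reps.Fb_KT, OF assms] representedI[OF pair_reps.Fb_N, OF assms]
    representedI[OF pair_reps.Fb_P, OF assms]
  have step: "represented (Oct \<alpha> 0 0 \<beta>) b"
    if "dot3 p (vprod3 q r) = 1" "coord_map p q r b = b'" "represented (Oct \<alpha> 0 0 \<beta>) b'" for p q r b'
    using coord_map_oct_aut[OF that(1)] _ that(2,3) by (rule represented_step) simp
  consider "u = 0" "v = 0" | "u \<noteq> 0" "v = 0" | "u = 0" "v \<noteq> 0"
    | "u \<noteq> 0" "v \<noteq> 0" "dot3 u v = 0" | "dot3 u v \<noteq> 0"
    by blast
  then show ?thesis
  proof cases
    case 1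
    then show ?thesis
      using R b by simp
  next
    case 2
    then obtain v' where v': "dot3 v' u = 1"
      using dot3_surj by blast
    then have "v' \<noteq> 0"
      by auto
    then obtain q r where qr: "vprod3 q r = v'"
      by (rule vprod3_surj)
    then have det: "dot3 u (vprod3 q r) = 1"
      using v' by (simp add: dot3_commute)
    then have "coord_map u q r b = Oct \<gamma> (vector [1, 0, 0]) 0 \<delta>"
      by (simp add: b 2)
    with det show ?thesis
      using R(2) by (rule step)
  next
    case 3
    then obtain p where p: "dot3 p v = 1"
      using dot3_surj by blast
    obtain q r where qr: "vprod3 q r = v"
      using 3(2) by (rule vprod3_surj)
    have det: "dot3 p (vprod3 q r) = 1"
      using p qr by simp
    have "dot3 v q = 0" "dot3 v r = 0"
      by (simp_all flip: qr)
    then have "coord_map p q r b = Oct \<gamma> 0 (vector [1, 0, 0]) \<delta>"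
      using p by (simp add: b 3 dot3_commute)
    with det show ?thesis
      using R(3) by (rule step)
  next
    case 4
    \<comment> \<open>In the basis \<open>u, q, r\<close> the dual vector belonging to
      \<open>q\<close> is \<open>vprod3 r u\<close>, which is \<open>v\<close>.\<close>
    obtain r where r: "vprod3 r u = v"
      using 4(1,3) by (rule vprod3_left_surj)
    obtain q where q: "dot3 q v = 1"
      using 4(2) by (rule dot3_surj)
    have det: "dot3 u (vprod3 q r) = 1"
      using q r triple_product_rotate by metis
    have "dot3 v u = 0" "dot3 v r = 0"
      by (simp_all flip: r)
    then have "coord_map u q r b = Oct \<gamma> (vector [1, 0, 0]) (vector [0, 1, 0]) \<delta>"
      using det q by (simp add: b dot3_commute)
    with det show ?thesis
      using R(5) by (rule step)
  next
    case 5
    define s where "s = dot3 u v"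
    have s: "s \<noteq> 0" "(1 / s) *s v \<noteq> 0"
      using 5 by (auto simp: s_def)
    \<comment> \<open>This makes \<open>v\<close> a multiple by \<open>s\<close> of the dual vector
      belonging to \<open>u\<close>.\<close>
    obtain q r where qr: "vprod3 q r = (1 / s) *s v"
      using s(2) by (rule vprod3_surj)
    then have det: "dot3 u (vprod3 q r) = 1"
      using s by (simp add: s_def)
    have v: "v = s *s vprod3 q r"
      using s by (simp add: qr)
    have "dot3 v q = 0" "dot3 v r = 0"
      by (simp_all add: v)
    moreover have "dot3 v u = s"
      by (simp add: s_def dot3_commute)
    ultimately have "coord_map u q r b = Oct \<gamma> (vector [1, 0, 0]) (vector [s, 0, 0]) \<delta>"
      using det by (simp add: b)
    with det show ?thesis
      using R(4)[OF s(1)] by (rule step)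
  qed
qed

text \<open>This and the next two lemmas supply stabilisers of the nilpotent form: coordinate
  changes whose basis starts with the first unit vector, upper maps along that vector, and lower
  maps with \<open>w $ 1 = 0\<close>.\<close>

lemma nilpotent_coord_step:
  assumes det: "dot3 (vector [1, 0, 0]) (vprod3 q r) = 1"
    and "coord_map (vector [1, 0, 0]) q r b = b'"
    and "represented (Oct \<alpha> (vector [1, 0, 0]) 0 \<alpha>) b'"
  shows "represented (Oct \<alpha> (vector [1, 0, 0]) 0 \<alpha>) b"
  using coord_map_oct_aut[OF det] _ assms(2,3) by (rule represented_step) (simp add: det)

lemma nilpotent_upper_step:
  assumes "upper_map (vector [c, 0, 0]) b = b'"
    and "represented (Oct \<alpha> (vector [1, 0, 0]) 0 \<alpha>) b'"
  shows "represented (Oct \<alpha> (vector [1, 0, 0]) 0 \<alpha>) b"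
  using upper_map_oct_aut _ assms by (rule represented_step) (simp add: vec3_simps)

lemma nilpotent_lower_step:
  assumes "w $ 1 = 0" "lower_map w b = b'"
    and "represented (Oct \<alpha> (vector [1, 0, 0]) 0 \<alpha>) b'"
  shows "represented (Oct \<alpha> (vector [1, 0, 0]) 0 \<alpha>) b"
  using lower_map_oct_aut _ assms(2,3)
  by (rule represented_step) (simp add: vec3_simps assms(1))

text \<open>A lower map clears \<open>u $ 2\<close> and \<open>u $ 3\<close> and keeps
  \<open>v $ 1\<close>, a coordinate change makes \<open>v\<close> a multiple of the first unit
  vector, and an upper map removes the rest of \<open>u\<close>. The auxiliary facts treat these
  stages from the last to the first.\<close>

lemma represented_nilpotent_lower_coord_nonzero:
  assumes "v $ 1 \<noteq> 0"
  shows "represented (Oct \<alpha> (vector [1, 0, 0]) 0 \<alpha>) (Oct \<gamma> u v \<delta>)"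
proof -
  let ?R = "represented (Oct \<alpha> (vector [1, 0, 0]) 0 \<alpha>)"
  have 0: "?R (Oct \<gamma> 0 (vector [s, 0, 0]) \<delta>)" if "s \<noteq> 0" for \<gamma> s \<delta>
  proof (cases "lt \<gamma> \<delta> \<or> \<gamma> = \<delta>")
    case True
    then show ?thesis
      using that by (intro representedI pair_reps.K1_LbT)
  next
    case False
    then have "?R (Oct \<delta> 0 (vector [s, 0, 0]) \<gamma>)"
      using that total[of \<gamma> \<delta>] by (intro representedI pair_reps.K1_LbT) auto
    \<comment> \<open>The parameter is the nonzero root of
      \<open>(\<gamma> - \<delta> - t * s) * t\<close>: the upper entry stays zero while the
      diagonal entries are exchanged.\<close>
    moreover have "upper_map (vector [(\<gamma> - \<delta>) / s, 0, 0]) (Oct \<gamma> 0 (vector [s, 0, 0]) \<delta>)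
        = Oct \<delta> 0 (vector [s, 0, 0]) \<gamma>"
      using that by (simp add: vec3_simps)
    ultimately show ?thesis
      by (rule nilpotent_upper_step[rotated])
  qed
  have 1: "?R (Oct \<gamma> (vector [c, 0, 0]) (vector [s, 0, 0]) \<delta>)" if s: "s \<noteq> 0" for \<gamma> c s \<delta>
  proof -
    obtain t where t: "c + (\<gamma> - \<delta> - t * s) * t = 0"
      using s by (rule quadratic_root)
    then have "upper_map (vector [t, 0, 0]) (Oct \<gamma> (vector [c, 0, 0]) (vector [s, 0, 0]) \<delta>)
        = Oct (\<gamma> - t * s) 0 (vector [s, 0, 0]) (\<delta> + t * s)"
      by (simp add: vec3_simps)
    then show ?thesis
      using 0[OF s] by (rule nilpotent_upper_step)
  qed
  have 2: "?R (Oct \<gamma> (vector [c, 0, 0]) v \<delta>)" if v: "v $ 1 \<noteq> 0" for \<gamma> c v \<delta>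
  proof -
    have "(1 / v $ 1) *s v \<noteq> 0"
      using v by (auto simp: vec_eq_iff)
    then obtain q r where qr: "vprod3 q r = (1 / v $ 1) *s v"
      by (rule vprod3_surj)
    have det: "dot3 (vector [1, 0, 0]) (vprod3 q r) = 1"
      using v by (simp add: qr) (simp add: dot3_def)
    have v': "v = v $ 1 *s vprod3 q r"
      using v by (simp add: qr)
    have "dot3 v q = 0" "dot3 v r = 0"
      using v' dot3_scale dot3_vprod3_self' by (metis mult_zero_right)+
    moreover have "dot3 v (vector [1, 0, 0]) = v $ 1"
      by (simp add: dot3_def)
    moreover have "vector [c, 0, 0] = c *s (vector [1, 0, 0] :: 'a ^ 3)"
      by (simp add: vec_eq_iff forall_3)
    ultimately have "coord_map (vector [1, 0, 0]) q r (Oct \<gamma> (vector [c, 0, 0]) v \<delta>)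
        = Oct \<gamma> (vector [c, 0, 0]) (vector [v $ 1, 0, 0]) \<delta>"
      using det by simp
    with det show ?thesis
      using 1[OF v] by (rule nilpotent_coord_step)
  qed
  \<comment> \<open>Chosen so that the second and third coordinates of \<open>u + vprod3 w v\<close>
    vanish.\<close>
  define w :: "'a ^ 3" where "w = vector [0, u $ 3 / v $ 1, - u $ 2 / v $ 1]"
  have "lower_map w (Oct \<gamma> u v \<delta>)
      = Oct (\<gamma> - dot3 w u) (vector [(u + vprod3 w v) $ 1, 0, 0])
          (v + (\<gamma> - \<delta> - dot3 w u) *s w) (\<delta> + dot3 w u)"
    using assms by (simp add: w_def vprod3_def vec_eq_iff forall_3)
  then show ?thesis
    by (rule nilpotent_lower_step[rotated]) (auto intro!: 2 simp: w_def assms)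
qed

text \<open>If \<open>u\<close> is not a multiple of the first unit vector, the two extend to a
  unimodular basis and \<open>u\<close> becomes the second unit vector. Otherwise an upper map
  removes \<open>u\<close> when the diagonal entries differ, and \<open>u\<close> is already normal
  when they agree.\<close>

lemma represented_nilpotent_lower_zero:
  "represented (Oct \<alpha> (vector [1, 0, 0]) 0 \<alpha>) (Oct \<gamma> u 0 \<delta>)"
proof -
  let ?R = "represented (Oct \<alpha> (vector [1, 0, 0]) 0 \<alpha>)"
  consider "u $ 2 = 0" "u $ 3 = 0" "\<gamma> = \<delta>" | "u $ 2 = 0" "u $ 3 = 0" "\<gamma> \<noteq> \<delta>"
    | "vprod3 (vector [1, 0, 0]) u \<noteq> 0"
    by (auto simp: vprod3_def)
  then show ?thesis
  proof cases
    case 1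
    then have u: "u = vector [u $ 1, 0, 0]"
      by (simp add: vec_eq_iff forall_3)
    show ?thesis
    proof (cases "u $ 1 = 0")
      case True
      then have "u = 0"
        using 1 by (simp add: vec_eq_iff forall_3)
      then show ?thesis
        using representedI[OF pair_reps.K1_E] 1 by simp
    next
      case False
      then have "?R (Oct \<gamma> (vector [u $ 1, 0, 0]) 0 \<gamma>)"
        by (intro representedI pair_reps.K1_L1)
      then show ?thesis
        using 1(3) by (simp flip: u)
    qed
  next
    case 2
    have "upper_map (vector [- u $ 1 / (\<gamma> - \<delta>), 0, 0]) (Oct \<gamma> u 0 \<delta>) = Oct \<gamma> 0 0 \<delta>"
      using 2 by (simp add: vec3_simps)
    then show ?thesis
      using representedI[OF pair_reps.K1_F, OF 2(3)] by (rule nilpotent_upper_step)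
  next
    case 3
    then obtain r where "dot3 r (vprod3 (vector [1, 0, 0]) u) = 1"
      by (rule dot3_surj)
    then have det: "dot3 (vector [1, 0, 0]) (vprod3 u r) = 1" "dot3 u (vprod3 r (vector [1, 0, 0])) = 1"
      by (metis triple_product_rotate)+
    have e2: "?R (Oct \<gamma> (vector [0, 1, 0]) 0 \<delta>)"
    proof (cases "lt \<gamma> \<delta> \<or> \<gamma> = \<delta>")
      case True
      then show ?thesis
        by (intro representedI pair_reps.K1_Mb)
    next
      case False
      then have rep: "?R (Oct \<delta> (vector [0, 1, 0]) 0 \<gamma>)"
        using total[of \<gamma> \<delta>] by (intro representedI pair_reps.K1_Mb) auto
      have eq: "lower_map (vector [0, \<gamma> - \<delta>, 0]) (Oct \<gamma> (vector [0, 1, 0]) 0 \<delta>)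
          = Oct \<delta> (vector [0, 1, 0]) 0 \<gamma>"
        by (simp add: vec3_simps)
      show ?thesis
        by (rule nilpotent_lower_step[OF _ eq rep]) simp
    qed
    have "coord_map (vector [1, 0, 0]) u r (Oct \<gamma> u 0 \<delta>) = Oct \<gamma> (vector [0, 1, 0]) 0 \<delta>"
      using det by simp
    with det(1) show ?thesis
      using e2 by (rule nilpotent_coord_step)
  qed
qed

text \<open>All cases but the last reduce to \<open>v = 0\<close>: by a lower map along
  \<open>v\<close>, or by an upper map if \<open>dot3 v u = 0\<close> and \<open>u\<close> is not a
  multiple of the first unit vector. In the last case \<open>v\<close> becomes the second unit
  vector.\<close>

lemma represented_nilpotent_lower_coord_zero:
  assumes v: "v $ 1 = 0"
  shows "represented (Oct \<alpha> (vector [1, 0, 0]) 0 \<alpha>) (Oct \<gamma> u v \<delta>)"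
proof -
  let ?R = "represented (Oct \<alpha> (vector [1, 0, 0]) 0 \<alpha>)"
  consider "v = 0" | "dot3 v u \<noteq> 0" | "dot3 v u = 0" "u $ 2 \<noteq> 0 \<or> u $ 3 \<noteq> 0"
    | "v \<noteq> 0" "u $ 2 = 0" "u $ 3 = 0" "\<gamma> \<noteq> \<delta>" | "v \<noteq> 0" "u $ 2 = 0" "u $ 3 = 0" "\<gamma> = \<delta>"
    by blast
  then show ?thesis
  proof cases
    case 1
    then show ?thesis
      by (simp add: represented_nilpotent_lower_zero)
  next
    case 2
    then obtain t where t: "1 + (\<gamma> - \<delta> - t * dot3 v u) * t = 0"
      by (rule quadratic_root)
    have "v + (\<gamma> - \<delta> - t * dot3 v u) *s (t *s v) = (1 + (\<gamma> - \<delta> - t * dot3 v u) * t) *s v"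
      by (simp add: vec_eq_iff algebra_simps)
    then have "lower_map (t *s v) (Oct \<gamma> u v \<delta>) = Oct (\<gamma> - t * dot3 v u) u 0 (\<delta> + t * dot3 v u)"
      using t by simp
    then show ?thesis
      using represented_nilpotent_lower_zero by (rule nilpotent_lower_step[rotated]) (simp add: v)
  next
    case 3
    \<comment> \<open>Orthogonality of \<open>u\<close> and \<open>v\<close> makes the two equations
      for \<open>c\<close> consistent; the one with a nonzero coefficient is solved.\<close>
    define c where "c = (if u $ 2 = 0 then v $ 2 / u $ 3 else - v $ 3 / u $ 2)"
    have "v $ 2 * u $ 2 + v $ 3 * u $ 3 = 0"
      using 3(1) v by (simp add: dot3_def)
    then have "v + vprod3 (vector [c, 0, 0]) u = 0"
      using 3(2) v by (auto simp: c_def vec3_simps field_simps eq_neg_iff_add_eq_0)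
    then have "\<exists>\<gamma>' u' \<delta>'. upper_map (vector [c, 0, 0]) (Oct \<gamma> u v \<delta>) = Oct \<gamma>' u' 0 \<delta>'"
      by simp
    then show ?thesis
      using represented_nilpotent_lower_zero nilpotent_upper_step by metis
  next
    case 4
    have "dot3 v u = 0"
      using 4 v by (simp add: dot3_def)
    then have "lower_map ((1 / (\<delta> - \<gamma>)) *s v) (Oct \<gamma> u v \<delta>) = Oct \<gamma> u 0 \<delta>"
      using 4(4) by (simp add: vec_eq_iff field_simps)
    then show ?thesis
      using represented_nilpotent_lower_zero by (rule nilpotent_lower_step[rotated]) (simp add: v)
  next
    case 5
    have u: "u = u $ 1 *s vector [1, 0, 0]"
      using 5 by (simp add: vec_eq_iff forall_3)
    have v1: "dot3 (vector [1, 0, 0]) v = 0"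
      using v by (simp add: dot3_def)
    then obtain r where r: "vprod3 r (vector [1, 0, 0]) = v"
      using vprod3_left_surj[of "vector [1, 0, 0]" v] by auto
    obtain q where q: "dot3 q v = 1"
      using 5(1) by (rule dot3_surj)
    have det: "dot3 (vector [1, 0, 0]) (vprod3 q r) = 1"
      using q r triple_product_rotate by metis
    have "dot3 v r = 0"
      by (simp flip: r)
    moreover have "dot3 u (vprod3 q r) = u $ 1" "dot3 u (vprod3 r (vector [1, 0, 0])) = 0"
      "dot3 u (vprod3 (vector [1, 0, 0]) q) = 0"
      by (subst u, simp add: det)+
    ultimately have "coord_map (vector [1, 0, 0]) q r (Oct \<gamma> u v \<delta>)
        = Oct \<gamma> (vector [u $ 1, 0, 0]) (vector [0, 1, 0]) \<gamma>"
      using q v1 5 by (simp add: dot3_commute)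
    moreover have "?R (Oct \<gamma> (vector [u $ 1, 0, 0]) (vector [0, 1, 0]) \<gamma>)"
    \<comment> \<open>The cross product of this parameter with the second unit vector is
      \<open>vector [- u $ 1, 0, 0]\<close>, which cancels the upper entry.\<close>
    proof (rule nilpotent_lower_step[of "vector [0, 0, u $ 1]"])
      show "lower_map (vector [0, 0, u $ 1]) (Oct \<gamma> (vector [u $ 1, 0, 0]) (vector [0, 1, 0]) \<gamma>)
          = Oct \<gamma> 0 (vector [0, 1, 0]) \<gamma>"
        by (simp add: vec3_simps)
    qed (auto intro: representedI pair_reps.K1_M1T)
    ultimately show ?thesis
      by (rule nilpotent_coord_step[OF det])
  qed
qed

lemma pair_normal_form: "represented a b"
proof -
  obtain g where g: "g \<in> oct_aut" "g a \<in> oct_reps lt"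
    using oct_normal_form by blast
  from g(2) have "represented (g a) (g b)"
  proof cases
    case (Nilpotent \<alpha>)
    then show ?thesis
      using represented_nilpotent_lower_coord_nonzero represented_nilpotent_lower_coord_zero by (cases "g b") metis
  qed (simp_all add: represented_scalar represented_diagonal)
  then show ?thesis
    using represented_step[OF g(1) refl refl] by blast
qed

end

section \<open>Invariants\<close>

fun oct_trace :: "'a::field octonion \<Rightarrow> 'a" where
  "oct_trace (Oct a u v b) = a + b"

fun oct_norm :: "'a::field octonion \<Rightarrow> 'a" where
  "oct_norm (Oct a u v b) = a * b - dot3 u v"

lemma octonion_square: "x * x = oct_trace x *\<^sub>O x - oct_norm x *\<^sub>O 1"
  by (cases x) (simp add: vec3_simps algebra_simps)

text \<open>A nonscalar octonion is linearly independent of the unity.\<close>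

lemma oct_scale_cancel:
  fixes x :: "'a::field octonion"
  assumes "c *\<^sub>O x = d *\<^sub>O x + e *\<^sub>O 1" and "\<And>k. x \<noteq> k *\<^sub>O 1"
  shows "c = d"
proof (rule ccontr)
  assume "c \<noteq> d"
  obtain a u v b where x: "x = Oct a u v b"
    by (cases x)
  have "c *s u = d *s u" "c *s v = d *s v" "c * a - d * a = c * b - d * b"
    using assms(1) by (simp_all add: x)
  then have "u = 0" "v = 0" "(c - d) * a = (c - d) * b"
    using \<open>c \<noteq> d\<close> by (simp_all add: vec_eq_iff left_diff_distrib)
  then have "x = a *\<^sub>O 1"
    using \<open>c \<noteq> d\<close> by (simp add: x)
  with assms(2) show False
    by blast
qed

text \<open>Applying \<open>g\<close> to the characteristic equation of \<open>x\<close> gives a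
  second quadratic equation for \<open>g x\<close>. For nonscalar \<open>x\<close> its coefficients
  must agree with those of the characteristic equation of \<open>g x\<close>.\<close>

lemma oct_trace_norm_aut:
  assumes g: "g \<in> oct_aut"
  shows "oct_trace (g x) = oct_trace x \<and> oct_norm (g x) = oct_norm x"
proof (cases "\<exists>c. x = c *\<^sub>O 1")
  case True
  then show ?thesis
    by (auto simp: oct_aut_scalar[OF g])
next
  case False
  then have nonscalar: "\<And>c. g x \<noteq> c *\<^sub>O 1"
    by (simp add: oct_aut_eq_scalar_iff[OF g])
  have "oct_trace (g x) *\<^sub>O g x - oct_norm (g x) *\<^sub>O 1 = oct_trace x *\<^sub>O g x - oct_norm x *\<^sub>O 1"
    using arg_cong[OF octonion_square[of x], of g] octonion_square[of "g x"]
    by (simp only: oct_aut_mult[OF g] oct_aut_diff[OF g] oct_aut_scale[OF g] oct_aut_one[OF g])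
  then have eq: "oct_trace (g x) *\<^sub>O g x
      = oct_trace x *\<^sub>O g x + (oct_norm (g x) - oct_norm x) *\<^sub>O 1"
    by (cases "g x") (simp add: vec_eq_iff algebra_simps)
  with nonscalar have tr: "oct_trace (g x) = oct_trace x"
    by (rule oct_scale_cancel[rotated])
  with eq have "oct_norm (g x) - oct_norm x = 0"
    by (cases "g x") simp
  with tr show ?thesis
    by simp
qed

lemmas oct_trace_aut = oct_trace_norm_aut[THEN conjunct1]
  and oct_norm_aut = oct_trace_norm_aut[THEN conjunct2]

text \<open>Both diagonal idempotents are linear combinations of the fixed element and the unity, so
  \<open>g\<close> fixes them and commutes with the Peirce projections. The dot product then comes
  from the norm.\<close>

lemma oct_aut_diagonal_invariants:
  assumes g: "g \<in> oct_aut" "g (Oct \<alpha> 0 0 \<beta>) = Oct \<alpha> 0 0 \<beta>" and "\<alpha> \<noteq> \<beta>"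
    and b: "g (Oct \<gamma> u v \<delta>) = Oct \<gamma>' u' v' \<delta>'"
  shows "\<gamma>' = \<gamma> \<and> \<delta>' = \<delta> \<and> (u' = 0 \<longleftrightarrow> u = 0) \<and> (v' = 0 \<longleftrightarrow> v = 0) \<and> dot3 u' v' = dot3 u v"
proof -
  let ?e = "Oct 1 0 0 0" and ?f = "Oct 0 0 0 1"
  note aut = oct_aut_add[OF g(1)] oct_aut_diff[OF g(1)] oct_aut_scale[OF g(1)] oct_aut_mult[OF g(1)]
  have "?e = (1 / (\<alpha> - \<beta>)) *\<^sub>O (Oct \<alpha> 0 0 \<beta> - \<beta> *\<^sub>O 1)"
    using \<open>\<alpha> \<noteq> \<beta>\<close> by simp
  then have e: "g ?e = ?e"
    using aut oct_aut_one[OF g(1)] g(2) by metis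
  have "?f = 1 - ?e"
    by (simp add: one_octonion_def)
  then have f: "g ?f = ?f"
    using aut oct_aut_one[OF g(1)] e by metis
  have "g ((?e * Oct \<gamma> u v \<delta>) * ?e) = (?e * Oct \<gamma>' u' v' \<delta>') * ?e"
    by (simp only: aut e b)
  then have "g (\<gamma> *\<^sub>O ?e) = \<gamma>' *\<^sub>O ?e"
    by simp
  then have \<gamma>: "\<gamma>' = \<gamma>"
    unfolding aut e by simp
  have "g ((?f * Oct \<gamma> u v \<delta>) * ?f) = (?f * Oct \<gamma>' u' v' \<delta>') * ?f"
    by (simp only: aut f b)
  then have "g (\<delta> *\<^sub>O ?f) = \<delta>' *\<^sub>O ?f"
    by simp
  then have \<delta>: "\<delta>' = \<delta>"
    unfolding aut f by simp
  have "g ((?e * Oct \<gamma> u v \<delta>) * ?f) = (?e * Oct \<gamma>' u' v' \<delta>') * ?f"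
    by (simp only: aut e f b)
  then have "g (Oct 0 u 0 0) = Oct 0 u' 0 0"
    by simp
  then have u: "u' = 0 \<longleftrightarrow> u = 0"
    using oct_aut_eq_scalar_iff[OF g(1), of "Oct 0 u 0 0" 0] by simp
  have "g ((?f * Oct \<gamma> u v \<delta>) * ?e) = (?f * Oct \<gamma>' u' v' \<delta>') * ?e"
    by (simp only: aut e f b)
  then have "g (Oct 0 0 v 0) = Oct 0 0 v' 0"
    by simp
  then have v: "v' = 0 \<longleftrightarrow> v = 0"
    using oct_aut_eq_scalar_iff[OF g(1), of "Oct 0 0 v 0" 0] by simp
  have "dot3 u' v' = dot3 u v"
    using oct_norm_aut[OF g(1), of "Oct \<gamma> u v \<delta>"] by (simp add: b \<gamma> \<delta>)
  with \<gamma> \<delta> u v show ?thesis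
    by blast
qed

text \<open>For \<open>b = Oct \<gamma> u v \<delta>\<close> the trace of \<open>x * b\<close> is
  \<open>v $ 1\<close>. The relation \<open>x * b = c *\<^sub>O x\<close> says that
  \<open>v $ 1 = 0\<close>, that \<open>u\<close> is a multiple of the first unit vector and that
  \<open>\<delta> = c\<close>; \<open>b * x = c *\<^sub>O x\<close> says the same with
  \<open>\<gamma>\<close> for \<open>\<delta>\<close>.\<close>

lemma oct_aut_nilpotent_invariants:
  fixes \<alpha> :: "'a::field"
  defines "x \<equiv> Oct 0 (vector [1, 0, 0]) 0 0"
  assumes g: "g \<in> oct_aut" "g (Oct \<alpha> (vector [1, 0, 0]) 0 \<alpha>) = Oct \<alpha> (vector [1, 0, 0]) 0 \<alpha>"
  shows "oct_trace (x * g b) = oct_trace (x * b)"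
    and "x * g b = c *\<^sub>O x \<longleftrightarrow> x * b = c *\<^sub>O x"
    and "g b * x = c *\<^sub>O x \<longleftrightarrow> b * x = c *\<^sub>O x"
    and "g b = c *\<^sub>O 1 + d *\<^sub>O x \<longleftrightarrow> b = c *\<^sub>O 1 + d *\<^sub>O x"
proof -
  note aut = oct_aut_add[OF g(1)] oct_aut_diff[OF g(1)] oct_aut_scale[OF g(1)] oct_aut_mult[OF g(1)]
    oct_aut_one[OF g(1)]
  have "x = Oct \<alpha> (vector [1, 0, 0]) 0 \<alpha> - \<alpha> *\<^sub>O 1"
    by (simp add: x_def)
  then have x: "g x = x"
    using aut g(2) by metis
  have "oct_trace (g (x * b)) = oct_trace (x * b)"
    by (rule oct_trace_aut[OF g(1)])
  then show "oct_trace (x * g b) = oct_trace (x * b)"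
    by (simp only: aut x)
  show "x * g b = c *\<^sub>O x \<longleftrightarrow> x * b = c *\<^sub>O x"
    using oct_aut_eq_iff[OF g(1), of "x * b" "c *\<^sub>O x"] by (simp only: aut x)
  show "g b * x = c *\<^sub>O x \<longleftrightarrow> b * x = c *\<^sub>O x"
    using oct_aut_eq_iff[OF g(1), of "b * x" "c *\<^sub>O x"] by (simp only: aut x)
  show "g b = c *\<^sub>O 1 + d *\<^sub>O x \<longleftrightarrow> b = c *\<^sub>O 1 + d *\<^sub>O x"
    using oct_aut_eq_iff[OF g(1), of b "c *\<^sub>O 1 + d *\<^sub>O x"] by (simp only: aut x)
qed

section \<open>Uniqueness of the normal forms\<close>

lemma sum_prod_eq_cases:
  fixes a b c d :: "'a::field"
  assumes "a + b = c + d" "a * b = c * d"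
  shows "a = c \<and> b = d \<or> a = d \<and> b = c"
proof -
  have "(a - c) * (a - d) = 0"
    using assms by algebra
  then show ?thesis
    using assms(1) by auto
qed

context tournament
begin

lemma sum_prod_le_unique:
  assumes "a + b = c + d" "a * b = c * d" "lt a b \<or> a = b" "lt c d \<or> c = d"
  shows "a = c \<and> b = d"
  using sum_prod_eq_cases[OF assms(1,2)] assms(3,4) irrefl total by metis

text \<open>Trace and norm determine the ordered diagonal entries. The remaining ambiguity, scalar
  or not, is settled because automorphisms fix scalars.\<close>

lemma oct_reps_unique:
  assumes g: "g \<in> oct_aut" and a: "a \<in> oct_reps lt" and ga: "g a \<in> oct_reps lt"
  shows "g a = a"
proof -
  have ex: "\<exists>\<alpha> \<beta>. (lt \<alpha> \<beta> \<or> \<alpha> = \<beta>) \<and> oct_trace a = \<alpha> + \<beta> \<and> oct_norm a = \<alpha> * \<beta> \<and>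
      (a = Oct \<alpha> 0 0 \<beta> \<or> a = Oct \<alpha> (vector [1, 0, 0]) 0 \<alpha> \<and> \<alpha> = \<beta>)"
    if "a \<in> oct_reps lt" for a
    using that by cases auto
  obtain \<alpha> \<beta> where 1: "lt \<alpha> \<beta> \<or> \<alpha> = \<beta>" "oct_trace a = \<alpha> + \<beta>" "oct_norm a = \<alpha> * \<beta>"
    "a = Oct \<alpha> 0 0 \<beta> \<or> a = Oct \<alpha> (vector [1, 0, 0]) 0 \<alpha> \<and> \<alpha> = \<beta>"
    using ex[OF a] by blast
  obtain \<gamma> \<delta> where 2: "lt \<gamma> \<delta> \<or> \<gamma> = \<delta>" "oct_trace (g a) = \<gamma> + \<delta>" "oct_norm (g a) = \<gamma> * \<delta>"
    "g a = Oct \<gamma> 0 0 \<delta> \<or> g a = Oct \<gamma> (vector [1, 0, 0]) 0 \<gamma> \<and> \<gamma> = \<delta>"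
    using ex[OF ga] by blast
  have "\<gamma> = \<alpha> \<and> \<delta> = \<beta>"
    using 1 2 oct_trace_aut[OF g, of a] oct_norm_aut[OF g, of a] by (intro sum_prod_le_unique) simp_all
  with 1(4) 2(4) show ?thesis
    using oct_aut_eq_scalar_iff[OF g, of a \<alpha>] by metis
qed

lemma pair_reps_fst: "(a, b) \<in> pair_reps lt \<Longrightarrow> a \<in> oct_reps lt"
  by (erule pair_reps.cases) (auto intro: oct_reps.intros)

lemma pair_reps_scalar: "(Oct \<alpha> 0 0 \<alpha>, b) \<in> pair_reps lt \<Longrightarrow> b \<in> oct_reps lt"
  by (erule pair_reps.cases) (auto intro: oct_reps.intros simp: irrefl)

lemma pair_reps_diagonal:
  assumes "(Oct \<alpha> 0 0 \<beta>, b) \<in> pair_reps lt" "\<alpha> \<noteq> \<beta>"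
  obtains \<gamma> u v \<delta> where "b = Oct \<gamma> u v \<delta>"
    "u = 0 \<and> v = 0 \<or> u = vector [1, 0, 0] \<and> v = 0 \<or> u = 0 \<and> v = vector [1, 0, 0] \<or>
      u = vector [1, 0, 0] \<and> (\<exists>s. s \<noteq> 0 \<and> v = vector [s, 0, 0]) \<or>
      u = vector [1, 0, 0] \<and> v = vector [0, 1, 0]"
  using assms by (cases rule: pair_reps.cases) auto

lemma pair_reps_nilpotent:
  assumes "(Oct \<alpha> (vector [1, 0, 0]) 0 \<alpha>, b) \<in> pair_reps lt"
  obtains (E) \<gamma> where "b = Oct \<gamma> 0 0 \<gamma>"
  | (F) \<gamma> \<delta> where "b = Oct \<gamma> 0 0 \<delta>" "\<gamma> \<noteq> \<delta>"
  | (L) \<gamma> s where "b = Oct \<gamma> (vector [s, 0, 0]) 0 \<gamma>" "s \<noteq> 0"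
  | (LT) \<gamma> s \<delta> where "b = Oct \<gamma> 0 (vector [s, 0, 0]) \<delta>" "s \<noteq> 0" "lt \<gamma> \<delta> \<or> \<gamma> = \<delta>"
  | (M) \<gamma> \<delta> where "b = Oct \<gamma> (vector [0, 1, 0]) 0 \<delta>" "lt \<gamma> \<delta> \<or> \<gamma> = \<delta>"
  | (MT) \<gamma> where "b = Oct \<gamma> 0 (vector [0, 1, 0]) \<gamma>"
  using assms by (cases rule: pair_reps.cases) auto

text \<open>Vanishing of \<open>u\<close> and \<open>v\<close> leaves only the two forms in which
  both are nonzero; the dot product is \<open>s \<noteq> 0\<close> in one and 0 in the
  other.\<close>

lemma pair_reps_unique_diagonal:
  assumes g: "g \<in> oct_aut" "g (Oct \<alpha> 0 0 \<beta>) = Oct \<alpha> 0 0 \<beta>" and "\<alpha> \<noteq> \<beta>"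
    and b: "(Oct \<alpha> 0 0 \<beta>, b) \<in> pair_reps lt" "(Oct \<alpha> 0 0 \<beta>, g b) \<in> pair_reps lt"
  shows "g b = b"
proof -
  obtain \<gamma> u v \<delta> where 1: "b = Oct \<gamma> u v \<delta>"
    "u = 0 \<and> v = 0 \<or> u = vector [1, 0, 0] \<and> v = 0 \<or> u = 0 \<and> v = vector [1, 0, 0] \<or>
      u = vector [1, 0, 0] \<and> (\<exists>s. s \<noteq> 0 \<and> v = vector [s, 0, 0]) \<or>
      u = vector [1, 0, 0] \<and> v = vector [0, 1, 0]"
    using pair_reps_diagonal[OF b(1) \<open>\<alpha> \<noteq> \<beta>\<close>] by metis
  obtain \<gamma>' u' v' \<delta>' where 2: "g b = Oct \<gamma>' u' v' \<delta>'"
    "u' = 0 \<and> v' = 0 \<or> u' = vector [1, 0, 0] \<and> v' = 0 \<or> u' = 0 \<and> v' = vector [1, 0, 0] \<or>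
      u' = vector [1, 0, 0] \<and> (\<exists>s. s \<noteq> 0 \<and> v' = vector [s, 0, 0]) \<or>
      u' = vector [1, 0, 0] \<and> v' = vector [0, 1, 0]"
    using pair_reps_diagonal[OF b(2) \<open>\<alpha> \<noteq> \<beta>\<close>] by metis
  have "\<gamma>' = \<gamma> \<and> \<delta>' = \<delta> \<and> (u' = 0 \<longleftrightarrow> u = 0) \<and> (v' = 0 \<longleftrightarrow> v = 0) \<and> dot3 u' v' = dot3 u v"
    using g \<open>\<alpha> \<noteq> \<beta>\<close> 2(1) unfolding 1(1) by (rule oct_aut_diagonal_invariants)
  with 1(2) 2(2) show ?thesis
    unfolding 2(1) unfolding 1(1) by (auto simp: dot3_def)
qed

text \<open>The trace of \<open>x * b\<close> singles out \<open>LT\<close> and its parameter, and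
  the relation for \<open>x * b\<close> separates \<open>M\<close> from the rest. The linear
  relation with \<open>1\<close> and \<open>x\<close> settles \<open>E\<close> and \<open>L\<close>;
  the two product relations give the diagonal in \<open>F\<close> and \<open>MT\<close>. In
  \<open>LT\<close> and \<open>M\<close> the ordered diagonal follows from trace and norm.\<close>

lemma pair_reps_unique_nilpotent:
  fixes \<alpha> :: 'a
  defines "a \<equiv> Oct \<alpha> (vector [1, 0, 0]) 0 \<alpha>"
  assumes g: "g \<in> oct_aut" "g a = a"
    and b: "(a, b) \<in> pair_reps lt" "(a, g b) \<in> pair_reps lt"
  shows "g b = b"
proof -
  obtain b' where b': "g b = b'"
    by blast
  note inv = oct_aut_nilpotent_invariants[OF g[unfolded a_def], of b, unfolded b']
    oct_trace_aut[OF g(1), of b, unfolded b'] oct_norm_aut[OF g(1), of b, unfolded b']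
  have scalar: "b' = Oct c 0 0 c \<longleftrightarrow> b = Oct c 0 0 c" for c
    using inv(4)[of c 0] by (simp add: vec_eq_iff)
  from b(1)[unfolded a_def] have "b' = b"
  proof (cases rule: pair_reps_nilpotent)
    case (E \<gamma>)
    then show ?thesis
      using scalar by simp
  next
    case (F \<gamma> \<delta>)
    from b(2)[unfolded a_def b'] show ?thesis
      by (cases rule: pair_reps_nilpotent)
        (use inv(2)[of \<delta>] inv(3)[of \<gamma>] inv(1) F in \<open>simp_all add: vec3_simps\<close>)
  next
    case (L \<gamma> s)
    then show ?thesis
      using inv(4)[of \<gamma> s] by (simp add: vec_eq_iff forall_3)
  next
    case (LT \<gamma> s \<delta>)
    from b(2)[unfolded a_def b'] show ?thesis
    proof (cases rule: pair_reps_nilpotent)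
      case LT': (LT \<gamma>' s' \<delta>')
      show ?thesis
        using inv(1,5,6) sum_prod_le_unique[of \<gamma> \<delta> \<gamma>' \<delta>'] LT LT' by (simp add: dot3_def)
    qed (use inv(1) LT in \<open>simp_all add: vec3_simps\<close>)
  next
    case (M \<gamma> \<delta>)
    from b(2)[unfolded a_def b'] show ?thesis
    proof (cases rule: pair_reps_nilpotent)
      case M': (M \<gamma>' \<delta>')
      show ?thesis
        using inv(5,6) sum_prod_le_unique[of \<gamma> \<delta> \<gamma>' \<delta>'] M M' by simp
    qed (use inv(1) inv(2) M in \<open>auto simp: vec3_simps\<close>)
  next
    case (MT \<gamma>)
    from b(2)[unfolded a_def b'] show ?thesis
    proof (cases rule: pair_reps_nilpotent)
      case (L \<gamma>' s')
      then show ?thesis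
        using inv(4)[of \<gamma>' s'] by (simp add: vec_eq_iff forall_3)
    qed (use inv(1) inv(2)[of \<gamma>] inv(3)[of \<gamma>] scalar MT in \<open>simp_all add: vec3_simps\<close>)
  qed
  with b' show ?thesis
    by simp
qed

lemma pair_reps_unique:
  assumes g: "g \<in> oct_aut" and "(a, b) \<in> pair_reps lt" "(g a, g b) \<in> pair_reps lt"
  shows "g a = a \<and> g b = b"
proof -
  note a = pair_reps_fst[OF assms(2)]
  have ga: "g a = a"
    using g a pair_reps_fst[OF assms(3)] by (rule oct_reps_unique)
  note b = assms(2) assms(3)[unfolded ga]
  from a have "g b = b"
  proof cases
    case (Scalar \<alpha>)
    then show ?thesis
      using g b pair_reps_scalar oct_reps_unique by blast
  next
    case (Diagonal \<alpha> \<beta>)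
    then have "\<alpha> \<noteq> \<beta>"
      using irrefl by blast
    then show ?thesis
      using pair_reps_unique_diagonal g ga b Diagonal(1) by blast
  next
    case (Nilpotent \<alpha>)
    then show ?thesis
      using pair_reps_unique_nilpotent g ga b by blast
  qed
  with ga show ?thesis
    by simp
qed

end

section \<open>From normal forms of pairs to orbits\<close>

theorem theorem4p4:
  fixes lt :: "'a::alg_closed_field \<Rightarrow> 'a \<Rightarrow> bool"
  assumes "\<And>\<alpha>. \<not> lt \<alpha> \<alpha>"
    and "\<And>\<alpha> \<beta>. \<alpha> \<noteq> \<beta> \<Longrightarrow> (lt \<alpha> \<beta> \<and> \<not> lt \<beta> \<alpha>) \<or> (lt \<beta> \<alpha> \<and> \<not> lt \<alpha> \<beta>)"
  shows "\<forall>\<Omega> \<in> orbits G2 (UNIV :: ('a octonion \<times> 'a octonion) set) diag_act.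
           \<exists>!p. p \<in> \<Omega> \<and> p \<in> pair_reps lt"
proof
  interpret tournament lt
    using assms by unfold_locales
  fix \<Omega> assume "\<Omega> \<in> orbits G2 (UNIV :: ('a octonion \<times> 'a octonion) set) diag_act"
  then obtain a b :: "'a octonion" where \<Omega>: "\<Omega> = {(g a, g b) |g. g \<in> oct_aut}"
    by (auto simp: orbits_def orbit_def G2_def diag_act_def)
  obtain g where g: "g \<in> oct_aut" "(g a, g b) \<in> pair_reps lt"
    using pair_normal_form unfolding represented_def by blast
  show "\<exists>!p. p \<in> \<Omega> \<and> p \<in> pair_reps lt"
  proof (rule ex1I)
    show "(g a, g b) \<in> \<Omega> \<and> (g a, g b) \<in> pair_reps lt"
      using g \<Omega> by blast
  next
    fix p assume p: "p \<in> \<Omega> \<and> p \<in> pair_reps lt"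
    then obtain h where h: "h \<in> oct_aut" "p = (h a, h b)"
      unfolding \<Omega> by blast
    \<comment> \<open>\<open>k\<close> carries one representative in the orbit to the other, so by
      uniqueness it fixes it.\<close>
    define k where "k = h \<circ> inv_into UNIV g"
    have "k \<in> oct_aut"
      unfolding k_def by (intro oct_aut_comp oct_aut_inv h(1) g(1))
    moreover have "inv_into UNIV g (g x) = x" for x
      using g(1) by (simp add: oct_aut_iff bij_is_inj inv_f_f)
    then have k: "k (g x) = h x" for x
      by (simp add: k_def)
    ultimately show "p = (g a, g b)"
      using pair_reps_unique[of k "g a" "g b"] g(2) p h(2) by (simp add: k)
  qed
qed

end
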